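(* Let $\mathcal{A}$ be a finite alphabet, let $B\subseteq\mathcal{A}^{\Delta_1}$ be an allowable set such that for every $\alpha\in\mathcal{A}$ there is a block in $B$ whose root label is $\alpha$ (so that every block in $B$ is extensible), let $X$ be the tree shift of finite type induced by $B$, and let $\mathcal{G}=(\mathcal{A},E_c,E_d)$ be the extended directed graph representation of $X$, so that $X=\mathsf{X}_{\mathcal{G}}$. Suppose that $\mathcal{G}$ is $(d,c)$-irreducible. Then $\mathsf{X}_{\mathcal{G}}$ is CPC-irreducible if and only if the intrinsic graph $\mathcal{G}^c$ is strongly connected.
   Context: Let $\Sigma=\{s_1,s_2\}$ and let $\Sigma^*$ be the set of all finite words over $\Sigma$ (the infinite dyadic tree), with empty word $\epsilon$; $|g|$ is the length of $g$, and $\Delta_n=\{g\in\Sigma^*: |g|\le n\}$. A labeled tree over a finite alphabet $\mathcal{A}$ is a function $t:\Sigma^*\to\mathcal{A}$, $g\mapsto t_g$. An $n$-block is a function $u:\Delta_n\to\mathcal{A}$; it appears in $t$ if for some $g\in\Sigma^*$, $t_{gw}=u_w$ for all $w\in\Delta_n$. A $1$-block $u$ with $u_\epsilon=\alpha,u_{s_1}=\beta,u_{s_2}=\gamma$ is written $\alpha\to(\beta,\gamma)$. For $B\subseteq\mathcal{A}^{\Delta_1}$, the tree shift of finite type (TSFT) induced by the allowable set $B$ is the set of all labeled trees $t$ with $t_g\to(t_{gs_1},t_{gs_2})\in B$ for all $g\in\Sigma^*$. A finite set $S\subseteq\Sigma^*$ is a prefix code if no word in $S$ is a prefix of another word in $S$;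 it is a complete prefix code (CPC) if moreover every $w\in\Sigma^*$ with $|w|\ge\max\{|g|:g\in S\}$ has a (not necessarily proper) prefix in $S$. Let $B_n(X)$ be the set of $n$-blocks appearing in elements of $X$. A tree shift $X$ is CPC-irreducible if for all $n$ and all $u,v\in B_n(X)$ there are $x\in X$ and a CPC $P\subset\bigcup_{k>n}\Sigma^k$ such that $x_w=u_w$ and $x_{gw}=v_w$ for all $w\in\Delta_n$ and $g\in P$. An extended directed graph is a triple $\mathcal{G}=(V,E_c,E_d)$ with $V$ a finite vertex set, $E_c\subset V\times V$ (convergent edges) and $E_d\subset V\times V\times V$ (divergent edges), where every $(\alpha,\beta,\gamma)\in E_d$ satisfies $\beta\ne\gamma$. Its intrinsic graph is the directed graph $\mathcal{G}^c=(V,E_c)$. A directed graph is strongly connected if for any two vertices $v_1,v_2$ there is a directed path from $v_1$ to $v_2$. $\mathsf{X}_{\mathcal{G}}$ is the TSFT over the alphabet $V$ induced by the allowable set $\{\alpha\to(\beta,\beta):(\alpha,\beta)\in E_c\}\cup\{\alpha\to(\beta,\gamma):(\alpha,\beta,\gamma)\in E_d\}$. The extended directed graph representation of the TSFT induced by $B$ has $V=\mathcal{A}$, $E_c=\{(\alpha,\beta):\alpha\to(\beta,\beta)\in B\}$, $E_d=\{(\alpha,\beta,\gamma):\beta\ne\gamma,\ \alpha\to(\beta,\gamma)\in B\}$. $\mathcal{G}=(V,E_c,E_d)$ is $(d,c)$-reducible if there are $\alpha,\beta,\gamma\in V$ such that $(\alpha,\beta,\gamma)\in E_d$ or $(\alpha,\gamma,\beta)\in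 E_d$, there is a directed path in $\mathcal{G}^c$ from $\beta$ to $\gamma$, and $(\alpha,\gamma)\notin E_c$. $\mathcal{G}$ is $(d,c)$-irreducible if it is not $(d,c)$-reducible. *)

theory Defs
  imports
    "HOL-Library.FuncSet"
    "HOL-Library.Sublist"
    "Graph_Theory.Digraph"
    "Graph_Theory.Pair_Digraph"
    "Graph_Theory.Digraph_Component"
begin

datatype gen = S1 | S2

text \<open>Words over the two generators; the empty word is \<open>[]\<close> and \<open>g w\<close> is \<open>g @ w\<close>.\<close>
type_synonym dword = "gen list"

type_synonym 'a ltree = "dword \<Rightarrow> 'a"

definition Delta :: "nat \<Rightarrow> dword set" where
  "Delta n = {g. length g \<le> n}"

text \<open>An \<open>n\<close>-block is a function with domain \<open>Delta n\<close>, encoded as a total function that is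
  \<open>undefined\<close> outside \<open>Delta n\<close>, so that equality of blocks is equality on \<open>Delta n\<close>.\<close>
definition blocks :: "'a set \<Rightarrow> nat \<Rightarrow> (dword \<Rightarrow> 'a) set" where
  "blocks A n = (Delta n \<rightarrow>\<^sub>E A)"

definition block1 :: "'a \<Rightarrow> 'a \<Rightarrow> 'a \<Rightarrow> (dword \<Rightarrow> 'a)" where
  "block1 \<alpha> \<beta> \<gamma> =
     (\<lambda>w\<in>Delta 1. if w = [] then \<alpha> else if w = [S1] then \<beta> else \<gamma>)"

definition tsft :: "'a set \<Rightarrow> (dword \<Rightarrow> 'a) set \<Rightarrow> 'a ltree set" where
  "tsft A B =
     {t. (\<forall>g. t g \<in> A) \<and> (\<forall>g. block1 (t g) (t (g @ [S1])) (t (g @ [S2])) \<in> B)}"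

definition appears :: "nat \<Rightarrow> (dword \<Rightarrow> 'a) \<Rightarrow> 'a ltree \<Rightarrow> bool" where
  "appears n u t \<longleftrightarrow> (\<exists>g. \<forall>w\<in>Delta n. t (g @ w) = u w)"

text \<open>The labels of a block appearing in a tree of \<open>X\<close> lie in the alphabet of \<open>X\<close>
  automatically, so the alphabet is not a parameter.\<close>
definition blocks_of :: "nat \<Rightarrow> 'a ltree set \<Rightarrow> (dword \<Rightarrow> 'a) set" where
  "blocks_of n X = {u \<in> extensional (Delta n). \<exists>t\<in>X. appears n u t}"

definition prefix_code :: "dword set \<Rightarrow> bool" where
  "prefix_code S \<longleftrightarrow> finite S \<and> (\<forall>g\<in>S. \<forall>h\<in>S. g \<noteq> h \<longrightarrow> \<not> prefix g h)"

text \<open>Nonemptiness is implicit in the use of \<open>max {|g| : g \<in> S}\<close>; it has to be explicit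
  here because \<open>Max {}\<close> is an unspecified number.\<close>
definition complete_prefix_code :: "dword set \<Rightarrow> bool" where
  "complete_prefix_code S \<longleftrightarrow>
     prefix_code S \<and> S \<noteq> {} \<and>
     (\<forall>w. length w \<ge> Max (length ` S) \<longrightarrow> (\<exists>g\<in>S. prefix g w))"

definition CPC_irreducible :: "'a ltree set \<Rightarrow> bool" where
  "CPC_irreducible X \<longleftrightarrow>
     (\<forall>n. \<forall>u\<in>blocks_of n X. \<forall>v\<in>blocks_of n X.
        \<exists>x\<in>X. \<exists>P. complete_prefix_code P \<and> P \<subseteq> {g. length g > n} \<and>
          (\<forall>w\<in>Delta n. x w = u w) \<and> (\<forall>w\<in>Delta n. \<forall>g\<in>P. x (g @ w) = v w))"

record 'a ext_digraph =
  everts :: "'a set"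
  cedges :: "('a \<times> 'a) set"
  dedges :: "('a \<times> 'a \<times> 'a) set"

definition wf_ext_digraph :: "'a ext_digraph \<Rightarrow> bool" where
  "wf_ext_digraph G \<longleftrightarrow>
     finite (everts G) \<and> cedges G \<subseteq> everts G \<times> everts G \<and>
     dedges G \<subseteq> everts G \<times> everts G \<times> everts G \<and>
     (\<forall>(\<alpha>, \<beta>, \<gamma>)\<in>dedges G. \<beta> \<noteq> \<gamma>)"

definition intrinsic_graph :: "'a ext_digraph \<Rightarrow> 'a pair_pre_digraph" where
  "intrinsic_graph G = \<lparr> pverts = everts G, parcs = cedges G \<rparr>"

text \<open>The library's \<^const>\<open>strongly_connected\<close> additionally requires a nonempty vertex set.\<close>
definition strongly_connected_graph :: "('a, 'b) pre_digraph \<Rightarrow> bool" where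
  "strongly_connected_graph D \<longleftrightarrow> (\<forall>v\<in>verts D. \<forall>w\<in>verts D. v \<rightarrow>\<^sup>*\<^bsub>D\<^esub> w)"

lemma strongly_connected_iff_graph:
  "strongly_connected D \<longleftrightarrow> verts D \<noteq> {} \<and> strongly_connected_graph D"
  by (simp add: strongly_connected_def strongly_connected_graph_def)

definition ext_digraph_shift :: "'a ext_digraph \<Rightarrow> 'a ltree set" where
  "ext_digraph_shift G =
     tsft (everts G)
       ({block1 \<alpha> \<beta> \<beta> | \<alpha> \<beta>. (\<alpha>, \<beta>) \<in> cedges G} \<union>
        {block1 \<alpha> \<beta> \<gamma> | \<alpha> \<beta> \<gamma>. (\<alpha>, \<beta>, \<gamma>) \<in> dedges G})"

definition ext_digraph_rep :: "'a set \<Rightarrow> (dword \<Rightarrow> 'a) set \<Rightarrow> 'a ext_digraph" where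
  "ext_digraph_rep A B =
     \<lparr> everts = A,
       cedges = {(\<alpha>, \<beta>). block1 \<alpha> \<beta> \<beta> \<in> B},
       dedges = {(\<alpha>, \<beta>, \<gamma>). \<beta> \<noteq> \<gamma> \<and> block1 \<alpha> \<beta> \<gamma> \<in> B} \<rparr>"

definition dc_reducible :: "'a ext_digraph \<Rightarrow> bool" where
  "dc_reducible G \<longleftrightarrow>
     (\<exists>\<alpha>\<in>everts G. \<exists>\<beta>\<in>everts G. \<exists>\<gamma>\<in>everts G.
        ((\<alpha>, \<beta>, \<gamma>) \<in> dedges G \<or> (\<alpha>, \<gamma>, \<beta>) \<in> dedges G) \<and>
        \<beta> \<rightarrow>\<^sup>*\<^bsub>with_proj (intrinsic_graph G)\<^esub> \<gamma> \<and>
        (\<alpha>, \<gamma>) \<notin> cedges G)"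

definition dc_irreducible :: "'a ext_digraph \<Rightarrow> bool" where
  "dc_irreducible G \<longleftrightarrow> \<not> dc_reducible G"

lemma block1_simps [simp]:
  "block1 \<alpha> \<beta> \<gamma> [] = \<alpha>" "block1 \<alpha> \<beta> \<gamma> [S1] = \<beta>" "block1 \<alpha> \<beta> \<gamma> [S2] = \<gamma>"
  by (auto simp: block1_def Delta_def)

lemma block1_inject [simp]:
  "block1 \<alpha> \<beta> \<gamma> = block1 \<alpha>' \<beta>' \<gamma>' \<longleftrightarrow> \<alpha> = \<alpha>' \<and> \<beta> = \<beta>' \<and> \<gamma> = \<gamma>'"
  by (metis block1_simps)

lemma block1_eta: "u \<in> blocks A 1 \<Longrightarrow> block1 (u []) (u [S1]) (u [S2]) = u"
proof (rule ext)
  fix w assume u: "u \<in> blocks A 1"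
  show "block1 (u []) (u [S1]) (u [S2]) w = u w"
  proof (cases "w \<in> Delta 1")
    case False
    with u show ?thesis
      by (auto simp: block1_def blocks_def PiE_def extensional_def)
  next
    case True
    then have "w = [] \<or> w = [S1] \<or> w = [S2]"
      by (cases w) (auto simp: Delta_def intro: gen.exhaust)
    then show ?thesis by auto
  qed
qed

lemma block1_labels:
  assumes "B \<subseteq> blocks A 1" "block1 \<alpha> \<beta> \<gamma> \<in> B"
  shows "\<alpha> \<in> A" "\<beta> \<in> A" "\<gamma> \<in> A"
proof -
  have "block1 \<alpha> \<beta> \<gamma> \<in> Delta 1 \<rightarrow>\<^sub>E A"
    using assms by (auto simp: blocks_def)
  then have *: "block1 \<alpha> \<beta> \<gamma> w \<in> A" if "w \<in> Delta 1" for w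
    using that by (rule PiE_mem)
  show "\<alpha> \<in> A" "\<beta> \<in> A" "\<gamma> \<in> A"
    using *[of "[]"] *[of "[S1]"] *[of "[S2]"] by (auto simp: Delta_def)
qed

lemma wf_ext_digraph_rep:
  assumes "finite A" "B \<subseteq> blocks A 1"
  shows "wf_ext_digraph (ext_digraph_rep A B)"
  using assms(1) block1_labels[OF assms(2)]
  by (auto simp: wf_ext_digraph_def ext_digraph_rep_def)

lemma ext_digraph_shift_rep: "ext_digraph_shift (ext_digraph_rep A B) = tsft A B"
proof -
  have "block1 \<alpha> \<beta> \<gamma> \<in> {block1 \<alpha> \<beta> \<beta> | \<alpha> \<beta>. block1 \<alpha> \<beta> \<beta> \<in> B} \<union>
      {block1 \<alpha> \<beta> \<gamma> | \<alpha> \<beta> \<gamma>. \<beta> \<noteq> \<gamma> \<and> block1 \<alpha> \<beta> \<gamma> \<in> B} \<longleftrightarrow> block1 \<alpha> \<beta> \<gamma> \<in> B" for \<alpha> \<beta> \<gamma>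
    by (cases "\<beta> = \<gamma>") auto
  then show ?thesis
    by (simp add: ext_digraph_shift_def ext_digraph_rep_def tsft_def)
qed

end

theory Submission
  imports Defs
begin

text \<open>If \<open>\<G>\<^sup>c\<close> is strongly connected, every leaf label of \<open>u\<close> is joined to the root label of
  \<open>v\<close> by a nonempty path of convergent edges; labelling whole levels by the vertices of the path
  and then planting a copy of a tree starting with \<open>v\<close> at each node of its last level gives the
  required tree.

  Conversely, choose \<open>\<gamma>\<close> in a strong component of \<open>\<G>\<^sup>c\<close> that no other component reaches, and let
  \<open>C\<close> be the set of vertices reaching \<open>\<gamma>\<close>, which is that component. If both children labels of an
  allowed block lie in \<open>C\<close>, they reach each other, so \<open>(d,c)\<close>-irreducibility turns a divergent edge
  into a convergent one and the root label is in \<open>C\<close> too. Going up from a complete prefix code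
  labelled by \<open>\<gamma>\<close>, every vertex is in \<open>C\<close>.\<close>

subsection \<open>Trees of a tree shift\<close>

fun graft :: "'a \<Rightarrow> 'a ltree \<Rightarrow> 'a ltree \<Rightarrow> 'a ltree" where
  "graft a t1 t2 [] = a"
| "graft a t1 t2 (S1 # w) = t1 w"
| "graft a t1 t2 (S2 # w) = t2 w"

lemma graft_in_tsft:
  assumes "a \<in> A" "t1 \<in> tsft A B" "t2 \<in> tsft A B" "block1 a (t1 []) (t2 []) \<in> B"
  shows "graft a t1 t2 \<in> tsft A B"
proof -
  have "graft a t1 t2 g \<in> A \<and>
      block1 (graft a t1 t2 g) (graft a t1 t2 (g @ [S1])) (graft a t1 t2 (g @ [S2])) \<in> B" for g
  proof (cases g)
    case Nil
    then show ?thesis using assms by simp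
  next
    case (Cons s w)
    then show ?thesis using assms(2,3) by (cases s) (auto simp: tsft_def)
  qed
  then show ?thesis by (simp add: tsft_def)
qed

lemma shift_in_tsft:
  assumes "t \<in> tsft A B"
  shows "(\<lambda>w. t (g @ w)) \<in> tsft A B"
  using assms unfolding tsft_def by (simp flip: append_assoc)

lemma tsft_root_block:
  assumes "t \<in> tsft A B"
  shows "block1 (t []) (t [S1]) (t [S2]) \<in> B"
  using assms unfolding tsft_def by (auto dest: spec[of _ "[]"])

lemma tsft_label: "t \<in> tsft A B \<Longrightarrow> t w \<in> A"
  by (simp add: tsft_def)

text \<open>Subtrees of a tree in the shift stay in the shift, so an occurrence of \<open>u\<close>
  at \<open>g\<close> can be moved to the root.\<close>

lemma blocks_of_tsft_obtain:
  assumes "u \<in> blocks_of n (tsft A B)"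
  obtains t where "t \<in> tsft A B" "\<forall>w\<in>Delta n. t w = u w"
proof -
  obtain t g where "t \<in> tsft A B" "\<forall>w\<in>Delta n. t (g @ w) = u w"
    using assms by (auto simp: blocks_of_def appears_def)
  with that[OF shift_in_tsft] show thesis by blast
qed

lemma root_block_obtain:
  assumes "B \<subseteq> blocks A 1" "\<forall>\<alpha>\<in>A. \<exists>u\<in>B. u [] = \<alpha>" "a \<in> A"
  obtains b c where "block1 a b c \<in> B"
  using assms block1_eta by (metis subsetD)

lemma tsft_root_exists:
  assumes "B \<subseteq> blocks A 1" "\<forall>\<alpha>\<in>A. \<exists>u\<in>B. u [] = \<alpha>" "a \<in> A"
  shows "\<exists>t\<in>tsft A B. t [] = a"
proof -
  have "\<forall>a\<in>A. \<exists>b c. block1 a b c \<in> B"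
    using root_block_obtain[OF assms(1,2)] by metis
  then obtain f h where fh: "\<And>a. a \<in> A \<Longrightarrow> block1 a (f a) (h a) \<in> B"
    by metis
  \<comment> \<open>Choosing the children as functions of the parent label makes the tree explicit.
    \<open>fold\<close> reads the word from the root down, so the label at \<open>g @ [s]\<close> is
    \<open>f\<close> or \<open>h\<close> of the label at \<open>g\<close>.\<close>
  define t where "t = (\<lambda>w. fold (\<lambda>s. if s = S1 then f else h) w a)"
  have "t w \<in> A" for w
    by (induction w rule: rev_induct)
      (use assms(3) block1_labels[OF assms(1) fh] in \<open>auto simp: t_def\<close>)
  with fh have "t \<in> tsft A B"
    by (simp add: tsft_def) (simp add: t_def)
  moreover have "t [] = a" by (simp add: t_def)
  ultimately show ?thesis by blast
qed

subsection \<open>Complete prefix codes\<close>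

text \<open>Any bound \<open>N\<close> may replace the maximal codeword length. Pad \<open>w\<close>
  to length at least \<open>N\<close>: the codeword found is no longer than \<open>w\<close>, hence
  a prefix of \<open>w\<close> itself.\<close>

lemma complete_prefix_codeI:
  assumes "prefix_code S" and cover: "\<And>w. length w \<ge> N \<Longrightarrow> \<exists>g\<in>S. prefix g w"
  shows "complete_prefix_code S"
proof -
  have fin: "finite S" using assms(1) by (simp add: prefix_code_def)
  have "\<exists>g\<in>S. prefix g w" if w: "length w \<ge> Max (length ` S)" for w
  proof -
    obtain g where g: "g \<in> S" "prefix g (w @ replicate N S1)"
      using cover[of "w @ replicate N S1"] by auto
    have "length g \<le> length w"
      using w g(1) fin by (meson Max_ge finite_imageI image_eqI order_trans)
    with g show ?thesis
      by (meson prefix_length_prefix prefixI)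
  qed
  moreover have "S \<noteq> {}" using cover[of "replicate N S1"] by auto
  ultimately show ?thesis using assms(1) by (simp add: complete_prefix_code_def)
qed

lemma complete_prefix_code_length: "complete_prefix_code {g. length g = k}"
proof (rule complete_prefix_codeI[where N = k])
  have "UNIV = {S1, S2}" using gen.exhaust by auto
  then have "finite (UNIV :: gen set)" by (metis finite.simps)
  then have "finite {g :: dword. length g = k}"
    using finite_lists_length_eq[of UNIV k] by simp
  then show "prefix_code {g. length g = k}"
    by (auto simp: prefix_code_def prefix_def)
  show "\<exists>g\<in>{g. length g = k}. prefix g w" if "length w \<ge> k" for w :: dword
    using that take_is_prefix[of k w] by (intro bexI[of _ "take k w"]) auto
qed

lemma complete_prefix_code_Cons_Un:
  assumes "complete_prefix_code P1" "complete_prefix_code P2"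
  shows "complete_prefix_code ((#) S1 ` P1 \<union> (#) S2 ` P2)"
proof (rule complete_prefix_codeI)
  show "prefix_code ((#) S1 ` P1 \<union> (#) S2 ` P2)"
    using assms unfolding complete_prefix_code_def prefix_code_def by (simp add: ball_Un)
  show "\<exists>g\<in>(#) S1 ` P1 \<union> (#) S2 ` P2. prefix g w"
    \<comment> \<open>The sum is a crude bound that dominates both maxima; \<open>Suc\<close> pays
      for the first letter.\<close>
    if w: "length w \<ge> Suc (Max (length ` P1) + Max (length ` P2))" for w
  proof -
    obtain s w' where w': "w = s # w'" using w by (cases w) auto
    have "\<exists>g\<in>P1. prefix g w'" "\<exists>g\<in>P2. prefix g w'"
      using assms w w' by (auto simp: complete_prefix_code_def)
    then show ?thesis using w' by (cases s) (auto simp: bex_Un)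
  qed
qed

text \<open>Carries a property from a covering set of nodes up to the root. If the root fails it,
  all covering prefixes are nonempty, so both subtrees satisfy the assumptions for depth
  \<open>N\<close>, and \<open>step\<close> contradicts the failure.\<close>

lemma tree_root_induct:
  assumes step: "\<And>g. C (t (g @ [S1])) \<Longrightarrow> C (t (g @ [S2])) \<Longrightarrow> C (t g)"
    and cover: "\<And>w. length w = N \<Longrightarrow> \<exists>g. prefix g w \<and> C (t g)"
  shows "C (t [])"
  using assms
proof (induction N arbitrary: t)
  case 0
  then show ?case by auto
next
  case (Suc N)
  show ?case
  proof (rule ccontr)
    assume root: "\<not> C (t [])"
    have "C (t [s])" for s
    proof (rule Suc.IH[of "\<lambda>w. t (s # w)"])
      show "C (t (s # g))" if "C (t (s # g @ [S1]))" "C (t (s # g @ [S2]))" for g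
        using Suc.prems(1)[of "s # g"] that by simp
      show "\<exists>g. prefix g w \<and> C (t (s # g))" if "length w = N" for w
        using Suc.prems(2)[of "s # w"] that root by (auto simp: prefix_Cons)
    qed
    then show False using Suc.prems(1)[of "[]"] root by simp
  qed
qed

subsection \<open>Reachability in the intrinsic graph\<close>

text \<open>Replaces library reachability by \<open>rtrancl\<close>. The latter is reflexive on the
  whole type, hence the condition that \<open>v\<close> is a vertex.\<close>

lemma reachable_intrinsic_graph_iff:
  assumes "wf_ext_digraph G"
  shows "v \<rightarrow>\<^sup>*\<^bsub>with_proj (intrinsic_graph G)\<^esub> w \<longleftrightarrow> v \<in> everts G \<and> (v, w) \<in> (cedges G)\<^sup>*"
proof -
  let ?D = "with_proj (intrinsic_graph G)"
  interpret wf_digraph ?D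
    by standard (use assms in \<open>auto simp: wf_ext_digraph_def intrinsic_graph_def\<close>)
  have ends: "arcs_ends ?D = cedges G"
    by (auto simp: arcs_ends_def arc_to_ends_def intrinsic_graph_def)
  show ?thesis
  proof
    assume "v \<rightarrow>\<^sup>*\<^bsub>?D\<^esub> w"
    then show "v \<in> everts G \<and> (v, w) \<in> (cedges G)\<^sup>*"
      using reachable_in_verts(1)[of v w] rtrancl_on_rtranclI[of v w]
      by (auto simp: reachable_def ends intrinsic_graph_def)
  next
    assume vw: "v \<in> everts G \<and> (v, w) \<in> (cedges G)\<^sup>*"
    then have v: "v \<in> verts ?D" by (simp add: intrinsic_graph_def)
    have "(v, w) \<in> (arcs_ends ?D)\<^sup>*" using vw unfolding ends ..
    then show "v \<rightarrow>\<^sup>*\<^bsub>?D\<^esub> w"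
      by (induction rule: rtrancl_induct) (use v in \<open>auto intro: reachable_adj_trans\<close>)
  qed
qed

lemma strongly_connected_intrinsic_graph_iff:
  assumes "wf_ext_digraph G"
  shows "strongly_connected_graph (with_proj (intrinsic_graph G)) \<longleftrightarrow>
    (\<forall>v\<in>everts G. \<forall>w\<in>everts G. (v, w) \<in> (cedges G)\<^sup>*)"
  unfolding strongly_connected_graph_def reachable_intrinsic_graph_iff[OF assms]
  by (auto simp: intrinsic_graph_def)

text \<open>Take \<open>c\<close> with the fewest ancestors. An ancestor \<open>b\<close> of
  \<open>c\<close> has no ancestors but those of \<open>c\<close>, so by minimality the two sets
  agree and \<open>c\<close> is an ancestor of \<open>b\<close>.\<close>

lemma initial_component_exists:
  assumes "finite V" "V \<noteq> {}"
  shows "\<exists>c\<in>V. \<forall>b\<in>V. (b, c) \<in> E\<^sup>* \<longrightarrow> (c, b) \<in> E\<^sup>*"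
proof -
  define anc where "anc c = {b \<in> V. (b, c) \<in> E\<^sup>*}" for c
  obtain v where "v \<in> V" using assms(2) by blast
  then obtain c where c: "c \<in> V" "\<And>b. b \<in> V \<Longrightarrow> card (anc c) \<le> card (anc b)"
    using ex_has_least_nat[of "\<lambda>c. c \<in> V" v "\<lambda>c. card (anc c)"] by blast
  have "(c, b) \<in> E\<^sup>*" if b: "b \<in> V" "(b, c) \<in> E\<^sup>*" for b
  proof -
    have "anc b \<subseteq> anc c" using b(2) by (auto simp: anc_def)
    moreover have "finite (anc c)" using assms(1) by (simp add: anc_def)
    ultimately have "anc b = anc c" using c(2)[OF b(1)] by (meson card_seteq)
    then show ?thesis using c(1) by (auto simp: anc_def)
  qed
  with c(1) show ?thesis by blast
qed

definition conv_edges :: "(dword \<Rightarrow> 'a) set \<Rightarrow> ('a \<times> 'a) set" where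
  "conv_edges B = {(\<alpha>, \<beta>). block1 \<alpha> \<beta> \<beta> \<in> B}"

lemma conv_edges_iff [simp]: "(\<alpha>, \<beta>) \<in> conv_edges B \<longleftrightarrow> block1 \<alpha> \<beta> \<beta> \<in> B"
  by (simp add: conv_edges_def)

subsection \<open>Irreducibility from strong connectedness\<close>

text \<open>Built from the end of the path: each edge puts a new root above two copies of the tree
  so far. As the path is nonempty, the copies of \<open>y\<close> start strictly below the
  root.\<close>

lemma chain_tree:
  assumes "(a, y []) \<in> (conv_edges B)\<^sup>+" "y \<in> tsft A B" "B \<subseteq> blocks A 1"
  shows "\<exists>k>0. \<exists>z\<in>tsft A B. z [] = a \<and> (\<forall>h w. length h = k \<longrightarrow> z (h @ w) = y w)"
  using assms(1)
proof (induction rule: converse_trancl_induct)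
  case (base a)
  then have "block1 a (y []) (y []) \<in> B" by simp
  then have "graft a y y \<in> tsft A B"
    using block1_labels(1)[OF assms(3)] assms(2) by (intro graft_in_tsft) auto
  moreover have "graft a y y (h @ w) = y w" if "length h = 1" for h w
    using that by (cases "(a, y, y, h)" rule: graft.cases) auto
  ultimately show ?case by (intro exI[of _ 1]) (auto intro!: bexI[of _ "graft a y y"])
next
  case (step a b)
  then obtain k z where kz: "k > 0" "z \<in> tsft A B" "z [] = b"
    "\<And>h w. length h = k \<Longrightarrow> z (h @ w) = y w" by auto
  have "block1 a (z []) (z []) \<in> B" using step(1) kz(3) by simp
  then have "graft a z z \<in> tsft A B"
    using block1_labels(1)[OF assms(3)] kz(2) by (intro graft_in_tsft) auto
  moreover have "graft a z z (h @ w) = y w" if "length h = Suc k" for h w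
    using that kz(4) by (cases "(a, z, z, h)" rule: graft.cases) auto
  ultimately show ?case by (intro exI[of _ "Suc k"]) (auto intro!: bexI[of _ "graft a z z"])
qed

text \<open>Induction on the depth to be preserved: treat both subtrees of \<open>t\<close>
  separately and join their codes. Paths from different leaves may differ in length, so the code
  need not be a single level.\<close>

lemma plant_below:
  assumes "B \<subseteq> blocks A 1" "y \<in> tsft A B"
    and conn: "\<And>a. a \<in> A \<Longrightarrow> (a, y []) \<in> (conv_edges B)\<^sup>+"
    and "t \<in> tsft A B"
  shows "\<exists>x\<in>tsft A B. \<exists>P. complete_prefix_code P \<and> P \<subseteq> {g. length g > n} \<and>
    (\<forall>w\<in>Delta n. x w = t w) \<and> (\<forall>w. \<forall>g\<in>P. x (g @ w) = y w)"
  using assms(4)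
proof (induction n arbitrary: t)
  case 0
  have "t [] \<in> A" using 0 by (rule tsft_label)
  from chain_tree[OF conn[OF this] assms(2,1)]
  obtain k z where "k > 0" "z \<in> tsft A B" "z [] = t []"
    "\<forall>h w. length h = k \<longrightarrow> z (h @ w) = y w"
    by auto
  then show ?case
    by (intro bexI[of _ z] exI[of _ "{g. length g = k}"])
      (auto simp: complete_prefix_code_length Delta_def)
next
  case (Suc n)
  have "(\<lambda>w. t (s # w)) \<in> tsft A B" for s
    using shift_in_tsft[OF Suc.prems, of "[s]"] by simp
  from Suc.IH[OF this] obtain x P where x: "x s \<in> tsft A B"
    and P: "complete_prefix_code (P s)" "P s \<subseteq> {g. length g > n}"
    and xt: "\<forall>w\<in>Delta n. x s w = t (s # w)" and xy: "\<forall>w. \<forall>g\<in>P s. x s (g @ w) = y w" for s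
    by metis
  let ?x = "graft (t []) (x S1) (x S2)"
  have "x s [] = t [s]" for s using xt by (auto simp: Delta_def)
  then have "?x \<in> tsft A B"
    using tsft_root_block[OF Suc.prems] tsft_label[OF Suc.prems] x by (intro graft_in_tsft) auto
  moreover have "?x w = t w" if "w \<in> Delta (Suc n)" for w
    using that xt by (cases "(t [], x S1, x S2, w)" rule: graft.cases) (auto simp: Delta_def)
  ultimately show ?case
    using P xy complete_prefix_code_Cons_Un[OF P(1) P(1), of S1 S2]
    by (intro bexI[of _ ?x] exI[of _ "(#) S1 ` P S1 \<union> (#) S2 ` P S2"]) fastforce+
qed

lemma CPC_irreducible_if_connected:
  assumes B: "B \<subseteq> blocks A 1" and ext: "\<forall>\<alpha>\<in>A. \<exists>u\<in>B. u [] = \<alpha>"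
    and conn: "\<forall>v\<in>A. \<forall>w\<in>A. (v, w) \<in> (conv_edges B)\<^sup>*"
  shows "CPC_irreducible (tsft A B)"
proof -
  have neq: "(a, b) \<in> (conv_edges B)\<^sup>+" if "a \<in> A" "b \<in> A" "a \<noteq> b" for a b
    using conn that by (meson rtranclD)
  \<comment> \<open>Strong connectedness gives only the empty path from \<open>a\<close> to itself.
    A block rooted at \<open>a\<close> gives either a loop at \<open>a\<close> or a second label, to
    which one can go and return.\<close>
  have loop: "(a, a) \<in> (conv_edges B)\<^sup>+" if a: "a \<in> A" for a
  proof -
    obtain b c where bc: "block1 a b c \<in> B" using root_block_obtain[OF B ext a] by blast
    note bcA = block1_labels(2,3)[OF B bc]
    show ?thesis
    proof (cases "b = a \<and> c = a")
      case True
      then show ?thesis using bc by auto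
    next
      case False
      then obtain d where "d \<in> A" "d \<noteq> a" using bcA by metis
      then show ?thesis using trancl_trans[OF neq neq, of a d a] a by simp
    qed
  qed
  show ?thesis
    unfolding CPC_irreducible_def
  proof (intro allI ballI)
    fix n u v
    assume u: "u \<in> blocks_of n (tsft A B)" and v: "v \<in> blocks_of n (tsft A B)"
    obtain t where t: "t \<in> tsft A B" "\<forall>w\<in>Delta n. t w = u w"
      using u by (rule blocks_of_tsft_obtain)
    obtain y where y: "y \<in> tsft A B" "\<forall>w\<in>Delta n. y w = v w"
      using v by (rule blocks_of_tsft_obtain)
    have "(a, y []) \<in> (conv_edges B)\<^sup>+" if "a \<in> A" for a
      using neq[OF that tsft_label[OF y(1)]] loop[OF that] by (cases "a = y []") simp_all
    from plant_below[OF B y(1) this t(1), of n]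
    obtain x P where "x \<in> tsft A B" "complete_prefix_code P" "P \<subseteq> {g. length g > n}"
      "\<forall>w\<in>Delta n. x w = t w" "\<forall>w. \<forall>g\<in>P. x (g @ w) = y w"
      by blast
    with t(2) y(2)
    show "\<exists>x\<in>tsft A B. \<exists>P. complete_prefix_code P \<and> P \<subseteq> {g. length g > n} \<and>
        (\<forall>w\<in>Delta n. x w = u w) \<and> (\<forall>w\<in>Delta n. \<forall>g\<in>P. x (g @ w) = v w)"
      by (intro bexI[of _ x] exI[of _ P]) auto
  qed
qed

subsection \<open>Strong connectedness from irreducibility\<close>

text \<open>The case \<open>n = 0\<close>, where a block is just a label.\<close>

lemma CPC_irreducible_join_labels:
  assumes irr: "CPC_irreducible X" and t: "t \<in> X" and s: "s \<in> X"
  shows "\<exists>x\<in>X. \<exists>P. complete_prefix_code P \<and> x [] = t [] \<and> (\<forall>g\<in>P. x g = s [])"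
proof -
  have block: "restrict r (Delta 0) \<in> blocks_of 0 X" if "r \<in> X" for r :: "'a ltree"
    using that by (auto simp: blocks_of_def appears_def intro!: bexI[of _ r] exI[of _ "[]"])
  have "\<exists>x\<in>X. \<exists>P. complete_prefix_code P \<and> P \<subseteq> {g. length g > 0} \<and>
      (\<forall>w\<in>Delta 0. x w = restrict t (Delta 0) w) \<and>
      (\<forall>w\<in>Delta 0. \<forall>g\<in>P. x (g @ w) = restrict s (Delta 0) w)"
    by (rule irr[unfolded CPC_irreducible_def, THEN spec, THEN bspec, OF block[OF t],
          THEN bspec, OF block[OF s]])
  then show ?thesis by (auto simp: Delta_def)
qed

lemma connected_if_CPC_irreducible:
  assumes fin: "finite A" and B: "B \<subseteq> blocks A 1" and ext: "\<forall>\<alpha>\<in>A. \<exists>u\<in>B. u [] = \<alpha>"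
    and dc: "\<And>\<alpha> \<beta> \<gamma>. block1 \<alpha> \<beta> \<gamma> \<in> B \<Longrightarrow>
      (\<beta>, \<gamma>) \<in> (conv_edges B)\<^sup>* \<Longrightarrow> block1 \<alpha> \<gamma> \<gamma> \<in> B"
    and irr: "CPC_irreducible (tsft A B)"
    and v: "v \<in> A" and w: "w \<in> A"
  shows "(v, w) \<in> (conv_edges B)\<^sup>*"
proof -
  obtain c where c: "c \<in> A" and init: "\<And>b. b \<in> A \<Longrightarrow> (b, c) \<in> (conv_edges B)\<^sup>* \<Longrightarrow> (c, b) \<in> (conv_edges B)\<^sup>*"
    using initial_component_exists[OF fin, of "conv_edges B"] v by blast
  have up: "(\<alpha>, c) \<in> (conv_edges B)\<^sup>*"
    if "block1 \<alpha> \<beta> \<gamma> \<in> B" "(\<beta>, c) \<in> (conv_edges B)\<^sup>*" "(\<gamma>, c) \<in> (conv_edges B)\<^sup>*" for \<alpha> \<beta> \<gamma>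
  proof -
    \<comment> \<open>Passes through \<open>c\<close>: \<beta> reaches \<open>c\<close>, and
      \<open>c\<close> reaches \<gamma> by \<open>init\<close>.\<close>
    have "(\<beta>, \<gamma>) \<in> (conv_edges B)\<^sup>*"
      using that init block1_labels(3)[OF B that(1)] by (meson rtrancl_trans)
    then have "(\<alpha>, \<gamma>) \<in> conv_edges B" using dc[OF that(1)] by simp
    then show ?thesis using that(3) by (rule converse_rtrancl_into_rtrancl)
  qed
  have reach: "(a, c) \<in> (conv_edges B)\<^sup>*" if a: "a \<in> A" for a
  proof -
    obtain x P where x: "x \<in> tsft A B" and P: "complete_prefix_code P"
      and xa: "x [] = a" and xc: "\<And>g. g \<in> P \<Longrightarrow> x g = c"
    proof -
      obtain t s where ts: "t \<in> tsft A B" "s \<in> tsft A B" "t [] = a" "s [] = c"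
        using tsft_root_exists[OF B ext a] tsft_root_exists[OF B ext c] by blast
      show thesis
        using CPC_irreducible_join_labels[OF irr ts(1,2)] ts(3,4) that by auto
    qed
    have "(x [], c) \<in> (conv_edges B)\<^sup>*"
    proof (rule tree_root_induct[where C = "\<lambda>b. (b, c) \<in> (conv_edges B)\<^sup>*"])
      show "(x g, c) \<in> (conv_edges B)\<^sup>*" if "(x (g @ [S1]), c) \<in> (conv_edges B)\<^sup>*" "(x (g @ [S2]), c) \<in> (conv_edges B)\<^sup>*" for g
        by (rule up[OF _ that]) (use x in \<open>simp add: tsft_def\<close>)
      \<comment> \<open>Words of maximal codeword length have a prefix in \<open>P\<close>, whose
        label \<open>c\<close> reaches itself.\<close>
      show "\<exists>g. prefix g w \<and> (x g, c) \<in> (conv_edges B)\<^sup>*" if "length w = Max (length ` P)" for w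
        using P that xc unfolding complete_prefix_code_def by (metis order_refl rtrancl.rtrancl_refl)
    qed
    with xa show ?thesis by simp
  qed
  show ?thesis using reach[OF v] init[OF w reach[OF w]] by (rule rtrancl_trans)
qed

theorem theorem6p1:
  fixes A :: "'a set" and B :: "(dword \<Rightarrow> 'a) set"
    and X :: "'a ltree set" and G :: "'a ext_digraph"
  assumes "finite A"
    and "B \<subseteq> blocks A 1"
    and "\<forall>\<alpha>\<in>A. \<exists>u\<in>B. u [] = \<alpha>"
    and "X = tsft A B"
    and "G = ext_digraph_rep A B"
    and "dc_irreducible G"
  shows "X = ext_digraph_shift G \<and>
    (CPC_irreducible (ext_digraph_shift G) \<longleftrightarrow>
      strongly_connected_graph (with_proj (intrinsic_graph G)))"
proof -
  have wf: "wf_ext_digraph G" using wf_ext_digraph_rep[OF assms(1,2)] assms(5) by simp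
  have G: "everts G = A" "cedges G = conv_edges B"
    "dedges G = {(\<alpha>, \<beta>, \<gamma>). \<beta> \<noteq> \<gamma> \<and> block1 \<alpha> \<beta> \<gamma> \<in> B}"
    by (simp_all add: assms(5) ext_digraph_rep_def conv_edges_def)
  have shift: "ext_digraph_shift G = tsft A B" using assms(5) by (simp add: ext_digraph_shift_rep)
  \<comment> \<open>For equal children this is the assumption; otherwise a missing convergent edge
    would witness reducibility.\<close>
  have dc: "block1 \<alpha> \<gamma> \<gamma> \<in> B" if "block1 \<alpha> \<beta> \<gamma> \<in> B" "(\<beta>, \<gamma>) \<in> (conv_edges B)\<^sup>*" for \<alpha> \<beta> \<gamma>
    using assms(6) that block1_labels[OF assms(2) that(1)]
    by (cases "\<beta> = \<gamma>")
      (auto simp: dc_irreducible_def dc_reducible_def reachable_intrinsic_graph_iff[OF wf] G)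
  have "CPC_irreducible (tsft A B) \<longleftrightarrow> (\<forall>v\<in>A. \<forall>w\<in>A. (v, w) \<in> (conv_edges B)\<^sup>*)"
  proof
    assume "CPC_irreducible (tsft A B)"
    then show "\<forall>v\<in>A. \<forall>w\<in>A. (v, w) \<in> (conv_edges B)\<^sup>*"
      by (intro ballI connected_if_CPC_irreducible[OF assms(1-3)]) (rule dc)
  qed (rule CPC_irreducible_if_connected[OF assms(2,3)])
  then show ?thesis
    using strongly_connected_intrinsic_graph_iff[OF wf] shift assms(4) by (simp add: G)
qed

end
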